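(* The price of non-splittability of SEBP equals $2$, i.e. $$\sup_I\frac{OPT_{\mathcal P}(I)}{OPT_{\mathcal R}(I)}=2,$$ where the supremum is over all instances $I$ of SEBP.
   Context: Stochastic extensible bin packing (SEBP): an instance $I=(\vec P,m)$ consists of $m\ge1$ identical machines, each with unit regular capacity, and $n$ jobs whose processing times $P_1,\dots,P_n$ are mutually independent nonnegative random variables with finite expectations. A scheduling policy maps each realization of the processing times to a feasible schedule (start times and machine assignments such that no machine processes two jobs at once) in a non-anticipatory way (decisions at time $t$ depend only on durations of jobs completed before $t$ and on the conditional distributions of the other processing times). For a policy $\Pi$ the workload $X_i^\Pi$ of machine $i$ is the latest completion time of a job assigned to $i$ and the cost is $\Phi(\Pi)=\mathbb E[\sum_i\max(X_i^\Pi,1)]$; $OPT_{\mathcal P}(I)$ is the infimum of $\Phi$ over all scheduling policies. A fractional assignment is a matrix $(a_{ij})$ with $a_{ij}\in[0,1]$, $\sum_i a_{ij}=1$ for every job $j$ (fixed in advance, parts of a job may run simultaneously), with cost $\sum_i\mathbb E[\max(\sum_j a_{ij}P_j,1)]$; $OPT_{\mathcal R}(I)$ is the infimum of this cost over all fractional assignments. *)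

theory Defs
  imports "HOL-Probability.Probability"
begin

text \<open>Machines are numbered \<open>0..<machines I\<close> and jobs \<open>0..<jobs I\<close>.\<close>

record 'a sebp =
  machines :: nat
  jobs :: nat
  sample_space :: "'a measure"
  ptime :: "nat \<Rightarrow> 'a \<Rightarrow> real"

definition sebp_instance :: "'a sebp \<Rightarrow> bool" where
  "sebp_instance I \<longleftrightarrow>
     machines I \<ge> 1 \<and>
     prob_space (sample_space I) \<and>
     prob_space.indep_vars (sample_space I) (\<lambda>_. borel) (ptime I) {..<jobs I} \<and>
     (\<forall>j<jobs I. (\<forall>\<omega>\<in>space (sample_space I). 0 \<le> ptime I j \<omega>) \<and> integrable (sample_space I) (ptime I j))"

definition realizations :: "nat \<Rightarrow> (nat \<Rightarrow> real) measure" where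
  "realizations n = (\<Pi>\<^sub>M j\<in>{..<n}. restrict_space borel {0..})"

definition realization :: "'a sebp \<Rightarrow> 'a \<Rightarrow> nat \<Rightarrow> real" where
  "realization I \<omega> = (\<lambda>j\<in>{..<jobs I}. ptime I j \<omega>)"

record schedule =
  start :: "nat \<Rightarrow> real"
  machine :: "nat \<Rightarrow> nat"

definition completion :: "(nat \<Rightarrow> real) \<Rightarrow> schedule \<Rightarrow> nat \<Rightarrow> real" where
  "completion p s j = start s j + p j"

definition feasible :: "nat \<Rightarrow> nat \<Rightarrow> (nat \<Rightarrow> real) \<Rightarrow> schedule \<Rightarrow> bool" where
  "feasible m n p s \<longleftrightarrow>
     (\<forall>j<n. 0 \<le> start s j \<and> machine s j < m) \<and>
     (\<forall>j<n. \<forall>k<n. j \<noteq> k \<and> machine s j = machine s k \<longrightarrow>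
        completion p s j \<le> start s k \<or> completion p s k \<le> start s j)"

text \<open>\<open>indistinguishable n p s r t p'\<close>: what has been observed at time \<open>t\<close> under the
  realization \<open>p\<close> and its schedule \<open>s\<close>, among the jobs \<open>k\<close> with \<open>r k\<close> (those started so far),
  is also compatible with the realization \<open>p'\<close>. A completed job has revealed its duration; a
  running one has revealed only that its duration exceeds the time elapsed since its start, which
  is the event its conditional distribution is taken with respect to; the other jobs have revealed
  nothing.\<close>

definition indistinguishable ::
  "nat \<Rightarrow> (nat \<Rightarrow> real) \<Rightarrow> schedule \<Rightarrow> (nat \<Rightarrow> bool) \<Rightarrow> real \<Rightarrow> (nat \<Rightarrow> real) \<Rightarrow> bool" where
  "indistinguishable n p s r t p' \<longleftrightarrow>
     (\<forall>k<n. r k \<longrightarrow>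
        (if completion p s k \<le> t then p' k = p k else p' k > t - start s k))"

text \<open>The numbers \<open>ord p j\<close> record the order in which the jobs are started. The order refines
  the start times and matters only for jobs started at the same instant: a job of duration 0 may
  be started and completed at time \<open>t\<close>, and another job started at the same time \<open>t\<close> in reaction
  to this. Without such an order, simultaneous decisions could depend on each other cyclically.\<close>

definition non_anticipatory :: "nat \<Rightarrow> ((nat \<Rightarrow> real) \<Rightarrow> schedule) \<Rightarrow> bool" where
  "non_anticipatory n \<sigma> \<longleftrightarrow>
     (\<exists>ord :: (nat \<Rightarrow> real) \<Rightarrow> nat \<Rightarrow> nat.
        \<forall>p\<in>space (realizations n).
          bij_betw (ord p) {..<n} {..<n} \<and>
          (\<forall>j<n. \<forall>k<n. ord p j < ord p k \<longrightarrow> start (\<sigma> p) j \<le> start (\<sigma> p) k) \<and>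
          (\<forall>j<n. \<forall>p'\<in>space (realizations n).
             indistinguishable n p (\<sigma> p) (\<lambda>k. ord p k < ord p j) (start (\<sigma> p) j) p' \<longrightarrow>
               start (\<sigma> p') j = start (\<sigma> p) j \<and>
               machine (\<sigma> p') j = machine (\<sigma> p) j \<and>
               ord p' j = ord p j))"

text \<open>A policy is chosen for a given instance, so its dependence on the (known) distributions is
  implicit.\<close>

definition policies :: "'a sebp \<Rightarrow> ((nat \<Rightarrow> real) \<Rightarrow> schedule) set" where
  "policies I =
     {\<sigma>. (\<forall>p\<in>space (realizations (jobs I)). feasible (machines I) (jobs I) p (\<sigma> p)) \<and>
          non_anticipatory (jobs I) \<sigma> \<and>
          (\<forall>j<jobs I.
             (\<lambda>p. start (\<sigma> p) j) \<in> borel_measurable (realizations (jobs I)) \<and>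
             (\<lambda>p. machine (\<sigma> p) j) \<in> measurable (realizations (jobs I)) (count_space UNIV))}"

text \<open>A machine to which no job is assigned has workload 0.\<close>

definition workload :: "nat \<Rightarrow> (nat \<Rightarrow> real) \<Rightarrow> schedule \<Rightarrow> nat \<Rightarrow> real" where
  "workload n p s i = Max (insert 0 (completion p s ` {j. j < n \<and> machine s j = i}))"

text \<open>Expectations are taken in \<open>[0, \<infinity>]\<close>, since a policy may insert idle times of infinite
  expectation.\<close>

definition policy_cost :: "'a sebp \<Rightarrow> ((nat \<Rightarrow> real) \<Rightarrow> schedule) \<Rightarrow> ennreal" where
  "policy_cost I \<sigma> =
     (\<integral>\<^sup>+\<omega>. ennreal (\<Sum>i<machines I.
        max (workload (jobs I) (realization I \<omega>) (\<sigma> (realization I \<omega>)) i) 1) \<partial>sample_space I)"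

definition opt_policy :: "'a sebp \<Rightarrow> ennreal" where
  "opt_policy I = (INF \<sigma>\<in>policies I. policy_cost I \<sigma>)"

definition fractional_assignments :: "'a sebp \<Rightarrow> (nat \<Rightarrow> nat \<Rightarrow> real) set" where
  "fractional_assignments I =
     {a. (\<forall>i<machines I. \<forall>j<jobs I. a i j \<in> {0..1}) \<and>
         (\<forall>j<jobs I. (\<Sum>i<machines I. a i j) = 1)}"

definition fractional_cost :: "'a sebp \<Rightarrow> (nat \<Rightarrow> nat \<Rightarrow> real) \<Rightarrow> ennreal" where
  "fractional_cost I a =
     (\<Sum>i<machines I. \<integral>\<^sup>+\<omega>. ennreal (max (\<Sum>j<jobs I. a i j * ptime I j \<omega>) 1) \<partial>sample_space I)"

definition opt_fractional :: "'a sebp \<Rightarrow> ennreal" where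
  "opt_fractional I = (INF a\<in>fractional_assignments I. fractional_cost I a)"

end

theory Submission
  imports Defs
begin

text \<open>Write \<open>S\<close> for the total processing time. Every fractional assignment costs at least
  \<open>max S m\<close> in each realization. A policy without idle time costs at most \<open>S + m\<close>, which is at most
  twice as much; processing all jobs on a single machine already suffices for this.
  Conversely, one deterministic job of length \<open>m\<close> costs \<open>2 m - 1\<close> under every policy, while
  splitting it evenly costs \<open>m\<close>, so the ratio \<open>2 - 1 / m\<close> is attained for every \<open>m\<close>.\<close>

lemma space_realizations: "space (realizations n) = {..<n} \<rightarrow>\<^sub>E {0..}"
  by (simp add: realizations_def space_PiM space_restrict_space)

lemma realizations_nonneg: "p \<in> space (realizations n) \<Longrightarrow> j < n \<Longrightarrow> 0 \<le> p j"
  by (auto simp: space_realizations)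

lemma measurable_realizations_component:
  assumes "j < n"
  shows "(\<lambda>p. p j) \<in> borel_measurable (realizations n)"
proof -
  have "(\<lambda>p. p j) \<in> realizations n \<rightarrow>\<^sub>M restrict_space borel {0..}"
    unfolding realizations_def using assms by (intro measurable_component_singleton) simp
  thus ?thesis
    by (simp add: measurable_restrict_space2_iff)
qed

lemma realization_in_realizations:
  assumes "sebp_instance I" "\<omega> \<in> space (sample_space I)"
  shows "realization I \<omega> \<in> space (realizations (jobs I))"
  using assms by (auto simp: space_realizations realization_def sebp_instance_def)

definition single_machine :: "(nat \<Rightarrow> real) \<Rightarrow> schedule" where
  "single_machine p = \<lparr>start = \<lambda>j. \<Sum>k<j. p k, machine = \<lambda>_. 0\<rparr>"

lemma completion_single_machine: "completion p (single_machine p) j = (\<Sum>k<Suc j. p k)"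
  by (simp add: completion_def single_machine_def)

lemma sum_realization_mono:
  assumes "p \<in> space (realizations n)" "j \<le> k" "k \<le> n"
  shows "(\<Sum>l<j. p l) \<le> (\<Sum>l<k. p l)"
  using assms by (intro sum_mono2) (auto intro: realizations_nonneg)

lemma feasible_single_machine:
  assumes "p \<in> space (realizations n)" "0 < m"
  shows "feasible m n p (single_machine p)"
proof -
  have "completion p (single_machine p) j \<le> start (single_machine p) k"
    if "j < k" "k < n" for j k
    unfolding completion_single_machine
    using that sum_realization_mono[OF assms(1), of "Suc j" k] by (simp add: single_machine_def)
  moreover have "0 \<le> start (single_machine p) j" if "j < n" for j
    using that sum_realization_mono[OF assms(1), of 0 j] by (simp add: single_machine_def)
  ultimately show ?thesis
    using assms(2) unfolding feasible_def
    by (metis linorder_neqE_nat schedule.select_convs(2) single_machine_def)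
qed

lemma non_anticipatory_single_machine: "non_anticipatory n single_machine"
  unfolding non_anticipatory_def
proof (intro exI[of _ "\<lambda>_ j. j"] ballI conjI allI impI)
  fix p assume p: "p \<in> space (realizations n)"
  show "bij_betw (\<lambda>j. j) {..<n} {..<n}"
    by (simp add: bij_betw_def)
  fix j k assume "k < n" "j < k"
  thus "start (single_machine p) j \<le> start (single_machine p) k"
    using sum_realization_mono[OF p, of j k] by (simp add: single_machine_def)
next
  fix p p' j
  assume p: "p \<in> space (realizations n)" and j: "j < n"
    and ind: "indistinguishable n p (single_machine p) (\<lambda>k. k < j) (start (single_machine p) j) p'"
  have "p' k = p k" if "k < j" for k
  proof -
    have "completion p (single_machine p) k \<le> start (single_machine p) j"
      unfolding completion_single_machine
      using that j sum_realization_mono[OF p, of "Suc k" j] by (simp add: single_machine_def)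
    thus ?thesis
      using ind that j unfolding indistinguishable_def by (metis order.strict_trans)
  qed
  thus "start (single_machine p') j = start (single_machine p) j"
    by (simp add: single_machine_def)
qed (simp_all add: single_machine_def)

lemma single_machine_policy:
  assumes "machines I \<ge> 1"
  shows "single_machine \<in> policies I"
  unfolding policies_def
proof (intro CollectI conjI ballI allI impI)
  fix j assume "j < jobs I"
  thus "(\<lambda>p. start (single_machine p) j) \<in> borel_measurable (realizations (jobs I))"
    unfolding single_machine_def schedule.select_convs
    by (intro borel_measurable_sum measurable_realizations_component) simp
  show "(\<lambda>p. machine (single_machine p) j) \<in> realizations (jobs I) \<rightarrow>\<^sub>M count_space UNIV"
    by (simp add: single_machine_def)
qed (use assms in \<open>auto intro: feasible_single_machine non_anticipatory_single_machine\<close>)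

lemma workload_single_machine_le:
  assumes "p \<in> space (realizations n)"
  shows "workload n p (single_machine p) i \<le> (if i = 0 then \<Sum>j<n. p j else 0)"
  unfolding workload_def
proof (rule Max.boundedI)
  fix x assume "x \<in> insert 0 (completion p (single_machine p) ` {j. j < n \<and> machine (single_machine p) j = i})"
  then consider "x = 0" | j where "j < n" "i = 0" "x = (\<Sum>k<Suc j. p k)"
    unfolding completion_single_machine image_iff insert_iff by (auto simp: single_machine_def)
  thus "x \<le> (if i = 0 then \<Sum>j<n. p j else 0)"
  proof cases
    case 1
    thus ?thesis using sum_realization_mono[OF assms, of 0 n] by simp
  next
    case 2
    thus ?thesis using sum_realization_mono[OF assms, of "Suc j" n] by simp
  qed
qed auto

lemma single_machine_cost_le:
  assumes "p \<in> space (realizations n)" "m \<ge> 1"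
  shows "(\<Sum>i<m. max (workload n p (single_machine p) i) 1) \<le> (\<Sum>j<n. p j) + m"
proof -
  have "0 \<le> (\<Sum>j<n. p j)"
    using sum_realization_mono[OF assms(1), of 0 n] by simp
  hence "max (workload n p (single_machine p) i) 1 \<le> (if i = 0 then \<Sum>j<n. p j else 0) + 1" for i
    using workload_single_machine_le[OF assms(1), of i] by (auto split: if_splits)
  hence "(\<Sum>i<m. max (workload n p (single_machine p) i) 1)
      \<le> (\<Sum>i<m. (if i = 0 then \<Sum>j<n. p j else 0) + 1)"
    by (intro sum_mono)
  also have "\<dots> = (\<Sum>j<n. p j) + m"
    using assms(2) by (simp add: sum.distrib)
  finally show ?thesis .
qed

lemma fractional_cost_ge:
  fixes a :: "nat \<Rightarrow> nat \<Rightarrow> real" and p :: "nat \<Rightarrow> real"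
  assumes "a \<in> fractional_assignments I"
  shows "max (\<Sum>j<jobs I. p j) (machines I)
    \<le> (\<Sum>i<machines I. max (\<Sum>j<jobs I. a i j * p j) 1)"
proof -
  have "(\<Sum>j<jobs I. p j) = (\<Sum>j<jobs I. (\<Sum>i<machines I. a i j) * p j)"
    using assms by (intro sum.cong) (auto simp: fractional_assignments_def)
  also have "\<dots> = (\<Sum>i<machines I. \<Sum>j<jobs I. a i j * p j)"
    by (subst sum.swap) (simp add: sum_distrib_right)
  also have "\<dots> \<le> (\<Sum>i<machines I. max (\<Sum>j<jobs I. a i j * p j) 1)"
    by (intro sum_mono) simp
  finally have "(\<Sum>j<jobs I. p j) \<le> (\<Sum>i<machines I. max (\<Sum>j<jobs I. a i j * p j) 1)" .
  moreover have "(\<Sum>i<machines I. 1) \<le> (\<Sum>i<machines I. max (\<Sum>j<jobs I. a i j * p j) 1)"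
    by (intro sum_mono) simp
  ultimately show ?thesis by simp
qed

lemma fractional_cost_eq:
  assumes "sebp_instance I"
  shows "fractional_cost I a = (\<integral>\<^sup>+\<omega>. ennreal (\<Sum>i<machines I.
      max (\<Sum>j<jobs I. a i j * ptime I j \<omega>) 1) \<partial>sample_space I)"
proof -
  have [measurable]: "j < jobs I \<Longrightarrow> ptime I j \<in> borel_measurable (sample_space I)" for j
    using assms by (auto simp: sebp_instance_def)
  have "fractional_cost I a = (\<integral>\<^sup>+\<omega>. (\<Sum>i<machines I.
      ennreal (max (\<Sum>j<jobs I. a i j * ptime I j \<omega>) 1)) \<partial>sample_space I)"
    unfolding fractional_cost_def by (subst nn_integral_sum) auto
  thus ?thesis by (simp add: sum_ennreal)
qed

lemma single_machine_cost_le_fractional_cost: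
  assumes "sebp_instance I" "a \<in> fractional_assignments I"
  shows "policy_cost I single_machine \<le> 2 * fractional_cost I a"
proof -
  have [measurable]: "j < jobs I \<Longrightarrow> ptime I j \<in> borel_measurable (sample_space I)" for j
    using assms(1) by (auto simp: sebp_instance_def)
  have m: "machines I \<ge> 1"
    using assms(1) by (simp add: sebp_instance_def)
  let ?F = "\<lambda>\<omega>. \<Sum>i<machines I. max (\<Sum>j<jobs I. a i j * ptime I j \<omega>) 1"
  have "policy_cost I single_machine \<le> (\<integral>\<^sup>+\<omega>. 2 * ennreal (?F \<omega>) \<partial>sample_space I)"
    unfolding policy_cost_def
  proof (rule nn_integral_mono)
    fix \<omega> assume "\<omega> \<in> space (sample_space I)"
    hence "(\<Sum>i<machines I. max (workload (jobs I) (realization I \<omega>) (single_machine (realization I \<omega>)) i) 1)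
        \<le> (\<Sum>j<jobs I. ptime I j \<omega>) + machines I"
      using single_machine_cost_le[OF realization_in_realizations[OF assms(1)] m]
      by (simp add: realization_def)
    also have "\<dots> \<le> 2 * ?F \<omega>"
      using fractional_cost_ge[OF assms(2), of "\<lambda>j. ptime I j \<omega>"] by simp
    finally have "ennreal (\<Sum>i<machines I. max (workload (jobs I) (realization I \<omega>)
        (single_machine (realization I \<omega>)) i) 1) \<le> ennreal (2 * ?F \<omega>)"
      by (rule ennreal_leI)
    also have "\<dots> = 2 * ennreal (?F \<omega>)"
      by (subst ennreal_mult') simp_all
    finally show "ennreal (\<Sum>i<machines I. max (workload (jobs I) (realization I \<omega>)
        (single_machine (realization I \<omega>)) i) 1) \<le> 2 * ennreal (?F \<omega>)" .
  qed
  also have "\<dots> = 2 * fractional_cost I a"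
    unfolding fractional_cost_eq[OF assms(1)] by (intro nn_integral_cmult) measurable
  finally show ?thesis .
qed

lemma opt_fractional_ge_machines:
  assumes "sebp_instance I"
  shows "of_nat (machines I) \<le> opt_fractional I"
  unfolding opt_fractional_def
proof (rule INF_greatest)
  fix a assume a: "a \<in> fractional_assignments I"
  interpret prob_space "sample_space I"
    using assms by (simp add: sebp_instance_def)
  have "of_nat (machines I) = (\<integral>\<^sup>+\<omega>. ennreal (machines I) \<partial>sample_space I)"
    by (simp add: emeasure_space_1 ennreal_of_nat_eq_real_of_nat)
  also have "\<dots> \<le> fractional_cost I a"
    unfolding fractional_cost_eq[OF assms]
    using fractional_cost_ge[OF a] by (intro nn_integral_mono ennreal_leI) simp
  finally show "of_nat (machines I) \<le> fractional_cost I a" .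
qed

lemma ratio_le_2:
  assumes "sebp_instance I"
  shows "opt_policy I / opt_fractional I \<le> 2"
proof (rule divide_le_posI_ennreal)
  show "0 < opt_fractional I"
    using opt_fractional_ge_machines[OF assms] assms unfolding sebp_instance_def
    by (metis le_zero_eq not_one_le_zero of_nat_eq_0_iff zero_less_iff_neq_zero)
  have le: "opt_policy I \<le> 2 * fractional_cost I a" if "a \<in> fractional_assignments I" for a
  proof -
    have "opt_policy I \<le> policy_cost I single_machine"
      unfolding opt_policy_def
      using assms by (intro INF_lower single_machine_policy) (simp add: sebp_instance_def)
    also have "\<dots> \<le> 2 * fractional_cost I a"
      by (rule single_machine_cost_le_fractional_cost[OF assms that])
    finally show ?thesis .
  qed
  have "opt_policy I / 2 \<le> opt_fractional I"
    unfolding opt_fractional_def by (intro INF_greatest divide_le_posI_ennreal le) auto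
  hence "opt_policy I / 2 * 2 \<le> opt_fractional I * 2"
    by (rule mult_right_mono) simp
  thus "opt_policy I \<le> opt_fractional I * 2"
    by (simp add: ennreal_divide_times)
qed

definition long_job :: "nat \<Rightarrow> 'a sebp" where
  "long_job m = \<lparr>machines = m, jobs = 1, sample_space = return (count_space UNIV) undefined,
     ptime = \<lambda>_ _. real m\<rparr>"

lemma sebp_instance_long_job:
  assumes "m \<ge> 1"
  shows "sebp_instance (long_job m :: 'a sebp)"
proof -
  let ?M = "return (count_space UNIV) undefined :: 'a measure"
  interpret prob_space ?M
    by (rule prob_space_return) simp
  have "indep_vars (\<lambda>_. borel) (\<lambda>(_::nat) _. real m) {..<1}"
    unfolding indep_vars_def2
    by (auto simp: indep_sets_def lessThan_Suc subset_singleton_iff prob_space)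
  thus ?thesis
    using assms prob_space_axioms by (simp add: sebp_instance_def long_job_def)
qed

lemma policy_cost_long_job_ge:
  assumes "m \<ge> 1" "\<sigma> \<in> policies (long_job m :: 'a sebp)"
  shows "ennreal (2 * real m - 1) \<le> policy_cost (long_job m :: 'a sebp) \<sigma>"
proof -
  let ?I = "long_job m :: 'a sebp"
  have I: "sebp_instance ?I" by (rule sebp_instance_long_job[OF assms(1)])
  interpret prob_space "sample_space ?I"
    using I by (simp add: sebp_instance_def)
  have "2 * real m - 1 \<le> (\<Sum>i<m. max (workload 1 (realization ?I \<omega>) (\<sigma> (realization ?I \<omega>)) i) 1)"
    if "\<omega> \<in> space (sample_space ?I)" for \<omega>
  proof -
    let ?p = "realization ?I \<omega>"
    define i where "i = machine (\<sigma> ?p) 0"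
    have "feasible m 1 ?p (\<sigma> ?p)"
      using assms(2) realization_in_realizations[OF I that]
      by (auto simp: policies_def long_job_def)
    hence i: "i < m" and "0 \<le> start (\<sigma> ?p) 0"
      by (auto simp: feasible_def i_def)
    hence "real m \<le> completion ?p (\<sigma> ?p) 0"
      by (simp add: completion_def realization_def long_job_def)
    also have "\<dots> \<le> workload 1 ?p (\<sigma> ?p) i"
      unfolding workload_def by (rule Max_ge) (auto simp: i_def)
    finally have w: "real m \<le> workload 1 ?p (\<sigma> ?p) i" .
    have "2 * real m - 1 = (\<Sum>k<m. (if k = i then real m - 1 else 0) + 1)"
      using i by (simp add: sum.distrib)
    also have "\<dots> \<le> (\<Sum>k<m. max (workload 1 ?p (\<sigma> ?p) k) 1)"
      using w by (intro sum_mono) auto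
    finally show ?thesis .
  qed
  hence "(\<integral>\<^sup>+\<omega>. ennreal (2 * real m - 1) \<partial>sample_space ?I) \<le> policy_cost ?I \<sigma>"
    unfolding policy_cost_def
    by (intro nn_integral_mono ennreal_leI) (simp add: long_job_def)
  thus ?thesis by (simp add: emeasure_space_1)
qed

lemma opt_fractional_long_job:
  assumes "m \<ge> 1"
  shows "opt_fractional (long_job m :: 'a sebp) = ennreal m"
proof (rule antisym)
  let ?I = "long_job m :: 'a sebp" and ?a = "\<lambda>_ _. 1 / real m"
  have I: "sebp_instance ?I" by (rule sebp_instance_long_job[OF assms])
  interpret prob_space "sample_space ?I"
    using I by (simp add: sebp_instance_def)
  have "?a \<in> fractional_assignments ?I"
    using assms by (auto simp: fractional_assignments_def long_job_def)
  hence "opt_fractional ?I \<le> fractional_cost ?I ?a"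
    unfolding opt_fractional_def by (rule INF_lower)
  also have "\<dots> = (\<integral>\<^sup>+\<omega>. ennreal m \<partial>sample_space ?I)"
    unfolding fractional_cost_eq[OF I] using assms by (simp add: long_job_def)
  also have "\<dots> = ennreal m"
    by (simp add: emeasure_space_1)
  finally show "opt_fractional ?I \<le> ennreal m" .
  show "ennreal m \<le> opt_fractional ?I"
    using opt_fractional_ge_machines[OF I]
    by (simp add: long_job_def ennreal_of_nat_eq_real_of_nat)
qed

lemma ratio_long_job_ge:
  assumes "m \<ge> 1"
  shows "ennreal (2 - 1 / m)
    \<le> opt_policy (long_job m :: 'a sebp) / opt_fractional (long_job m :: 'a sebp)"
proof -
  have "ennreal (2 - 1 / m) = ennreal (2 * real m - 1) / ennreal m"
    using assms by (subst divide_ennreal) (auto simp: field_simps)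
  also have "\<dots> \<le> opt_policy (long_job m :: 'a sebp) / opt_fractional (long_job m :: 'a sebp)"
    unfolding opt_policy_def opt_fractional_long_job[OF assms]
    by (intro divide_right_mono_ennreal INF_greatest policy_cost_long_job_ge assms)
  finally show ?thesis .
qed

theorem theorem1:
  shows "(SUP I\<in>{I :: 'a sebp. sebp_instance I}. opt_policy I / opt_fractional I) = 2"
proof (rule antisym)
  let ?S = "SUP I\<in>{I :: 'a sebp. sebp_instance I}. opt_policy I / opt_fractional I"
  show "?S \<le> 2"
    by (intro SUP_least) (simp add: ratio_le_2)
  have "(\<lambda>m. 2 - 1 / real m) \<longlonglongrightarrow> 2 - 0"
    by (intro tendsto_intros lim_1_over_n)
  hence "(\<lambda>m. ennreal (2 - 1 / real m)) \<longlonglongrightarrow> ennreal 2"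
    by (intro tendsto_ennrealI) simp
  moreover have "ennreal (2 - 1 / m) \<le> ?S" if "m \<ge> 1" for m :: nat
  proof -
    have "long_job m \<in> {I :: 'a sebp. sebp_instance I}"
      using sebp_instance_long_job[OF that] by simp
    thus ?thesis
      using ratio_long_job_ge[OF that] by (rule SUP_upper2)
  qed
  ultimately have "ennreal 2 \<le> ?S"
    by (intro LIMSEQ_le_const2) blast+
  thus "2 \<le> ?S" by simp
qed

end
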